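(* Fix $d\ge1$. For $L\ge1$ let $N=L^d$, let $q_N\in[0,1]$, $p_N=1-q_N$, and let $X_L=X_L^d(q_N)$ be bond percolation on the torus $T_L^d$ with retention probability $q_N$. Suppose $Lp_N\to0$ as $L\to\infty$, and suppose that $f:\mathbb N\to\mathbb N$ satisfies $f(N)=o(L)$. Put $$Y_L=\mathrm{Prune}_{f(N)}(X_L).$$ If $L$ ranges over all positive integers, then $(Y_L)$ does not have an $\mathrm{MSO}_1$ convergence law, and hence does not have an $\mathrm{MSO}_2$ convergence law.
   Context: $T_L^d=(\mathbb Z/L\mathbb Z)^d$ is the (simple) graph in which two vertices are adjacent if they differ by $1$ or $-1$ modulo $L$ in exactly one coordinate and agree in all other coordinates; it has $N=L^d$ vertices. $X_L^d(q_N)$ is the random subgraph of $T_L^d$ on the full vertex set in which each edge is retained with probability $q_N$ and omitted with probability $p_N=1-q_N$, independently. $\mathbb N$ denotes the positive integers. For a finite graph $G$ and an integer $m\ge1$, $\mathrm{Prune}_m(G)$ is the subgraph of $G$ induced on $\{v\in V(G):|C_G(v)|\ge m\}$, where $C_G(v)$ is the connected component of $v$. $\mathrm{MSO}_2$ is monadic second-order logic over the two-sorted incidence structure of a graph (a vertex sort, an edge sort, and the incidence relation): one may quantify over vertices, edges, sets of vertices and sets of edges. $\mathrm{MSO}_1$ is the fragment in which set variables range only over sets of vertices. $(Y_L)$ has a convergence law for a logic if $\mathbb P(Y_L\models\varphi)$ converges as $L\to\infty$ for every sentence $\varphi$ of that logic. *)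

theory Defs
  imports "HOL-Probability.Probability" "HOL-Library.Landau_Symbols" "HOL-Number_Theory.Cong"
begin

section \<open>Graphs, components, pruning\<close>

text \<open>Edges of a simple graph are two-element sets of vertices.\<close>

datatype 'a graph = Graph (verts: "'a set") (edges: "'a set set")

definition component :: "'a graph \<Rightarrow> 'a \<Rightarrow> 'a set" where
  "component G v = {w. (v, w) \<in> {(x, y). {x, y} \<in> edges G}\<^sup>*}"

definition induced_subgraph :: "'a graph \<Rightarrow> 'a set \<Rightarrow> 'a graph" where
  "induced_subgraph G S = Graph S {e \<in> edges G. e \<subseteq> S}"

definition prune :: "nat \<Rightarrow> 'a graph \<Rightarrow> 'a graph" where
  "prune m G = induced_subgraph G {v \<in> verts G. m \<le> card (component G v)}"

section \<open>Bond percolation on the torus\<close>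

text \<open>
  Vertices are maps from the coordinates \<open>{..<d}\<close> to the representatives \<open>0, \<dots>, L - 1\<close> of the
  residues modulo \<open>L\<close>, undefined outside \<open>{..<d}\<close>. The condition \<open>u i \<noteq> v i\<close> only matters for
  \<open>L = 1\<close>, where it excludes a loop; for \<open>L = 2\<close> the two congruences coincide and there are no
  parallel edges.
\<close>

definition torus_adj :: "nat \<Rightarrow> nat \<Rightarrow> (nat \<Rightarrow> int) \<Rightarrow> (nat \<Rightarrow> int) \<Rightarrow> bool" where
  "torus_adj d L u v \<longleftrightarrow>
     (\<exists>i<d. u i \<noteq> v i \<and>
        ([u i - v i = 1] (mod int L) \<or> [u i - v i = - 1] (mod int L)) \<and>
        (\<forall>j<d. j \<noteq> i \<longrightarrow> u j = v j))"

definition torus :: "nat \<Rightarrow> nat \<Rightarrow> (nat \<Rightarrow> int) graph" where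
  "torus d L =
     (let V = {..<d} \<rightarrow>\<^sub>E {0..<int L}
      in Graph V {{u, v} | u v. u \<in> V \<and> v \<in> V \<and> torus_adj d L u v})"

definition percolation :: "'a graph \<Rightarrow> real \<Rightarrow> 'a graph pmf" where
  "percolation G q =
     map_pmf (\<lambda>\<omega>. Graph (verts G) {e \<in> edges G. \<omega> e})
       (Pi_pmf (edges G) False (\<lambda>_. bernoulli_pmf q))"

section \<open>Monadic second-order logic of graphs\<close>

text \<open>
  There are four kinds of variables, each indexed by \<open>nat\<close>: vertices, edges, sets of vertices and
  sets of edges. The remaining connectives and the universal quantifiers are definable.
\<close>

datatype mso_var = V nat | E nat | VS nat | ES nat

datatype mso =
    EqV nat nat
  | EqE nat nat
  | Inc nat nat   \<comment> \<open>vertex, edge\<close>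
  | MemV nat nat  \<comment> \<open>vertex, set of vertices\<close>
  | MemE nat nat  \<comment> \<open>edge, set of edges\<close>
  | Neg mso
  | Conj mso mso
  | ExV nat mso
  | ExE nat mso
  | ExVS nat mso
  | ExES nat mso

primrec free_vars :: "mso \<Rightarrow> mso_var set" where
  "free_vars (EqV x y) = {V x, V y}"
| "free_vars (EqE a b) = {E a, E b}"
| "free_vars (Inc x a) = {V x, E a}"
| "free_vars (MemV x X) = {V x, VS X}"
| "free_vars (MemE a A) = {E a, ES A}"
| "free_vars (Neg \<phi>) = free_vars \<phi>"
| "free_vars (Conj \<phi> \<psi>) = free_vars \<phi> \<union> free_vars \<psi>"
| "free_vars (ExV x \<phi>) = free_vars \<phi> - {V x}"
| "free_vars (ExE a \<phi>) = free_vars \<phi> - {E a}"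
| "free_vars (ExVS X \<phi>) = free_vars \<phi> - {VS X}"
| "free_vars (ExES A \<phi>) = free_vars \<phi> - {ES A}"

primrec no_edge_sets :: "mso \<Rightarrow> bool" where
  "no_edge_sets (EqV x y) = True"
| "no_edge_sets (EqE a b) = True"
| "no_edge_sets (Inc x a) = True"
| "no_edge_sets (MemV x X) = True"
| "no_edge_sets (MemE a A) = False"
| "no_edge_sets (Neg \<phi>) = no_edge_sets \<phi>"
| "no_edge_sets (Conj \<phi> \<psi>) = (no_edge_sets \<phi> \<and> no_edge_sets \<psi>)"
| "no_edge_sets (ExV x \<phi>) = no_edge_sets \<phi>"
| "no_edge_sets (ExE a \<phi>) = no_edge_sets \<phi>"
| "no_edge_sets (ExVS X \<phi>) = no_edge_sets \<phi>"
| "no_edge_sets (ExES A \<phi>) = False"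

definition MSO2_sentences :: "mso set" where
  "MSO2_sentences = {\<phi>. free_vars \<phi> = {}}"

definition MSO1_sentences :: "mso set" where
  "MSO1_sentences = {\<phi> \<in> MSO2_sentences. no_edge_sets \<phi>}"

primrec sat :: "'a graph \<Rightarrow>
    (nat \<Rightarrow> 'a) \<Rightarrow> (nat \<Rightarrow> 'a set) \<Rightarrow> (nat \<Rightarrow> 'a set) \<Rightarrow> (nat \<Rightarrow> 'a set set) \<Rightarrow> mso \<Rightarrow> bool" where
  "sat G v e vs es (EqV x y) \<longleftrightarrow> v x = v y"
| "sat G v e vs es (EqE a b) \<longleftrightarrow> e a = e b"
| "sat G v e vs es (Inc x a) \<longleftrightarrow> v x \<in> e a"
| "sat G v e vs es (MemV x X) \<longleftrightarrow> v x \<in> vs X"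
| "sat G v e vs es (MemE a A) \<longleftrightarrow> e a \<in> es A"
| "sat G v e vs es (Neg \<phi>) \<longleftrightarrow> \<not> sat G v e vs es \<phi>"
| "sat G v e vs es (Conj \<phi> \<psi>) \<longleftrightarrow> sat G v e vs es \<phi> \<and> sat G v e vs es \<psi>"
| "sat G v e vs es (ExV x \<phi>) \<longleftrightarrow> (\<exists>u\<in>verts G. sat G (v(x := u)) e vs es \<phi>)"
| "sat G v e vs es (ExE a \<phi>) \<longleftrightarrow> (\<exists>c\<in>edges G. sat G v (e(a := c)) vs es \<phi>)"
| "sat G v e vs es (ExVS X \<phi>) \<longleftrightarrow> (\<exists>U. U \<subseteq> verts G \<and> sat G v e (vs(X := U)) es \<phi>)"
| "sat G v e vs es (ExES A \<phi>) \<longleftrightarrow> (\<exists>F. F \<subseteq> edges G \<and> sat G v e vs (es(A := F)) \<phi>)"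

text \<open>
  Satisfaction of a sentence does not depend on the assignment. Assignments are not required to
  take values in \<open>G\<close>, so that the empty graph, which pruning may produce, is a legitimate structure.
\<close>

definition models :: "'a graph \<Rightarrow> mso \<Rightarrow> bool" (infix "\<Turnstile>" 50) where
  "G \<Turnstile> \<phi> \<longleftrightarrow> (\<forall>v e vs es. sat G v e vs es \<phi>)"

text \<open>The value at index \<open>0\<close> is irrelevant for convergence.\<close>

definition has_convergence_law :: "mso set \<Rightarrow> (nat \<Rightarrow> 'a graph pmf) \<Rightarrow> bool" where
  "has_convergence_law \<L> Y \<longleftrightarrow>
     (\<forall>\<phi>\<in>\<L>. convergent (\<lambda>L. measure_pmf.prob (Y L) {G. G \<Turnstile> \<phi>}))"

end

theory Submission
  imports Defs
begin

text \<open>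
  The obstruction to a convergence law is the parity of \<open>L\<close>, and the sentence that sees it is
  bipartiteness, which existential quantification over one set of vertices expresses.

  For even \<open>L\<close> the torus is bipartite, with colour classes given by the parity of the sum of the
  coordinates; hence so is each of its subgraphs, and \<open>Y L\<close> satisfies the sentence with
  probability \<open>1\<close>. For odd \<open>L\<close> the vertices \<open>(k, 0, \<dots>, 0)\<close> form a cycle of odd length \<open>L\<close>. By the
  union bound it loses an edge with probability at most \<open>L * (1 - q)\<close>, which tends to \<open>0\<close>. If it
  loses none, it lies in a component with at least \<open>L\<close> vertices, so that pruning below the
  threshold \<open>f (L ^ d) \<le> L\<close> leaves it intact, and \<open>Y L\<close> contains an odd cycle. The probability of
  the sentence thus equals \<open>1\<close> along the even \<open>L\<close> and tends to \<open>0\<close> along the odd ones.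
\<close>

text \<open>
  For two-element edges, meeting both \<open>U\<close> and its complement means having one endpoint in each.
  The colour class \<open>U\<close> may leave the vertex set, so that bipartiteness is a condition on the edges
  alone and passes to subgraphs with the same \<open>U\<close>.
\<close>

definition bipartite :: "'a graph \<Rightarrow> bool" where
  "bipartite G \<longleftrightarrow> (\<exists>U. \<forall>c\<in>edges G. (\<exists>u\<in>c. u \<in> U) \<and> (\<exists>u\<in>c. u \<notin> U))"

definition bipartite_sentence :: mso where
  "bipartite_sentence =
     ExVS 0 (Neg (ExE 0 (Neg (Conj
       (ExV 0 (Conj (Inc 0 0) (MemV 0 0)))
       (ExV 0 (Conj (Inc 0 0) (Neg (MemV 0 0))))))))"

lemma bipartite_sentence_MSO1: "bipartite_sentence \<in> MSO1_sentences"
  by (auto simp: bipartite_sentence_def MSO1_sentences_def MSO2_sentences_def)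

text \<open>
  In the logic the colour class and the witnesses in it range over vertices only. Intersecting \<open>U\<close>
  with the vertex set accounts for this as long as the edges consist of vertices.
\<close>

lemma models_bipartite_sentence:
  assumes "\<Union>(edges G) \<subseteq> verts G"
  shows "G \<Turnstile> bipartite_sentence \<longleftrightarrow> bipartite G"
proof -
  have "G \<Turnstile> bipartite_sentence \<longleftrightarrow>
      (\<exists>U\<subseteq>verts G. \<forall>c\<in>edges G.
        (\<exists>u\<in>verts G. u \<in> c \<and> u \<in> U) \<and> (\<exists>u\<in>verts G. u \<in> c \<and> u \<notin> U))"
    by (simp add: models_def bipartite_sentence_def)
  also have "\<dots> \<longleftrightarrow> bipartite G"
  proof
    assume "bipartite G"
    then obtain U where U: "\<forall>c\<in>edges G. (\<exists>u\<in>c. u \<in> U) \<and> (\<exists>u\<in>c. u \<notin> U)"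
      by (auto simp: bipartite_def)
    have "(\<exists>u\<in>verts G. u \<in> c \<and> u \<in> U \<inter> verts G) \<and>
        (\<exists>u\<in>verts G. u \<in> c \<and> u \<notin> U \<inter> verts G)"
      if "c \<in> edges G" for c
    proof -
      have "c \<subseteq> verts G"
        using assms that by auto
      then show ?thesis
        using U[rule_format, OF that] by auto
    qed
    then show "\<exists>U\<subseteq>verts G. \<forall>c\<in>edges G.
        (\<exists>u\<in>verts G. u \<in> c \<and> u \<in> U) \<and> (\<exists>u\<in>verts G. u \<in> c \<and> u \<notin> U)"
      by (intro exI[of _ "U \<inter> verts G"]) simp
  qed (auto simp: bipartite_def, metis)
  finally show ?thesis .
qed

lemma bipartite_antimono: "bipartite G" if "bipartite H" "edges G \<subseteq> edges H"
  using that unfolding bipartite_def by blast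

lemma Union_edges_prune: "\<Union>(edges (prune m G)) \<subseteq> verts (prune m G)"
  by (auto simp: prune_def induced_subgraph_def)

lemma edges_prune_subset: "edges (prune m G) \<subseteq> edges G"
  by (auto simp: prune_def induced_subgraph_def)

lemma odd_closed_walk_not_bipartite:
  assumes walk: "\<And>k. k < n \<Longrightarrow> {c k, c (Suc k)} \<in> edges G"
    and closed: "c n = c 0" and "odd n"
  shows "\<not> bipartite G"
proof
  assume "bipartite G"
  then obtain U where U: "\<And>e. e \<in> edges G \<Longrightarrow> (\<exists>u\<in>e. u \<in> U) \<and> (\<exists>u\<in>e. u \<notin> U)"
    by (auto simp: bipartite_def)
  have alternate: "c (Suc k) \<in> U \<longleftrightarrow> c k \<notin> U" if "k < n" for k
    using U[OF walk[OF that]] by auto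
  have "k \<le> n \<Longrightarrow> c k \<in> U \<longleftrightarrow> (even k \<longleftrightarrow> c 0 \<in> U)" for k
    by (induction k) (auto simp: alternate)
  from this[of n] show False
    using closed \<open>odd n\<close> by simp
qed

lemma path_in_component:
  assumes "\<And>k. k < n \<Longrightarrow> {c k, c (Suc k)} \<in> edges G" "i \<le> n" "j \<le> n"
  shows "c j \<in> component G (c i)"
proof -
  let ?R = "{(x, y). {x, y} \<in> edges G}"
  have from_start: "k \<le> n \<Longrightarrow> (c 0, c k) \<in> ?R\<^sup>*" for k
    by (induction k) (auto intro: rtrancl_into_rtrancl simp: assms(1))
  have "sym ?R"
    by (auto simp: sym_def insert_commute)
  then have "(c i, c 0) \<in> ?R\<^sup>*"
    using from_start[OF assms(2)] by (metis sym_rtrancl symD)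
  with from_start[OF assms(3)] show ?thesis
    by (auto simp: component_def)
qed

lemma component_subset: "component G v \<subseteq> insert v (\<Union>(edges G))"
proof
  fix w assume "w \<in> component G v"
  then have "(v, w) \<in> {(x, y). {x, y} \<in> edges G}\<^sup>*"
    by (simp add: component_def)
  then show "w \<in> insert v (\<Union>(edges G))"
    by cases auto
qed

text \<open>
  All vertices of the walk lie in one component. Its first \<open>n\<close> vertices are distinct, so this
  component reaches the threshold and pruning keeps it whole. Finiteness matters because an
  infinite component would have cardinality \<open>0\<close>.
\<close>

lemma path_survives_prune:
  assumes "finite (verts G)" "\<Union>(edges G) \<subseteq> verts G"
    and walk: "\<And>k. k < n \<Longrightarrow> {c k, c (Suc k)} \<in> edges G"
    and inj: "inj_on c {..<n}" and "m \<le> n" and "k < n"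
  shows "{c k, c (Suc k)} \<in> edges (prune m G)"
proof -
  have large: "m \<le> card (component G (c i))" if "i \<le> n" for i
  proof -
    have "finite (component G (c i))"
      using component_subset assms(1,2) by (meson finite_insert finite_subset)
    moreover have "c ` {..<n} \<subseteq> component G (c i)"
      using path_in_component[of n c G i, OF walk that] by force
    ultimately have "card (c ` {..<n}) \<le> card (component G (c i))"
      by (rule card_mono)
    with inj \<open>m \<le> n\<close> show ?thesis
      by (simp add: card_image)
  qed
  with walk[OF \<open>k < n\<close>] \<open>k < n\<close> assms(2) show ?thesis
    by (auto simp: prune_def induced_subgraph_def)
qed

lemma finite_verts_torus: "finite (verts (torus d L))"
  by (simp add: torus_def Let_def finite_PiE)

lemma Union_edges_torus: "\<Union>(edges (torus d L)) \<subseteq> verts (torus d L)"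
  by (auto simp: torus_def Let_def)

lemma finite_edges_torus: "finite (edges (torus d L))"
  using finite_subset[OF Union_edges_torus finite_verts_torus] by (rule finite_UnionD)

text \<open>
  A step changes one coordinate by \<open>1\<close> or \<open>-1\<close> modulo \<open>L\<close>; for even \<open>L\<close> the parity of this
  change survives the reduction modulo \<open>L\<close>, so that every edge changes the parity of the
  coordinate sum.
\<close>

lemma bipartite_torus:
  assumes "even L"
  shows "bipartite (torus d L)"
proof -
  let ?U = "{u :: nat \<Rightarrow> int. even (\<Sum>i<d. u i)}"
  have "even (\<Sum>i<d. u i) \<longleftrightarrow> odd (\<Sum>i<d. v i)" if adj: "torus_adj d L u v" for u v
  proof -
    obtain i where i: "i < d"
      and step: "[u i - v i = 1] (mod int L) \<or> [u i - v i = - 1] (mod int L)"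
      and rest: "\<And>j. j < d \<Longrightarrow> j \<noteq> i \<Longrightarrow> u j = v j"
      using adj by (auto simp: torus_adj_def)
    have "(\<Sum>j<d. u j) = u i + (\<Sum>j\<in>{..<d}-{i}. u j)" "(\<Sum>j<d. v j) = v i + (\<Sum>j\<in>{..<d}-{i}. v j)"
      using i by (auto simp: sum.remove)
    moreover have "(\<Sum>j\<in>{..<d}-{i}. u j) = (\<Sum>j\<in>{..<d}-{i}. v j)"
      by (rule sum.cong) (auto simp: rest)
    ultimately have "(\<Sum>j<d. u j) - (\<Sum>j<d. v j) = u i - v i"
      by simp
    moreover have "odd (u i - v i)"
    proof -
      have "2 dvd int L" using assms by simp
      with step have "[u i - v i = 1] (mod 2) \<or> [u i - v i = - 1] (mod 2)"
        using cong_dvd_modulus by blast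
      then show ?thesis
        by (auto simp: cong_def) presburger+
    qed
    ultimately show ?thesis
      by (metis diff_add_cancel even_add)
  qed
  then have "\<forall>e\<in>edges (torus d L). (\<exists>u\<in>e. u \<in> ?U) \<and> (\<exists>u\<in>e. u \<notin> ?U)"
    by (auto simp: torus_def Let_def)
  then show ?thesis
    unfolding bipartite_def by blast
qed

text \<open>
  Reducing the index modulo \<open>L\<close> closes the walk: the vertices with indices \<open>L\<close> and \<open>0\<close> coincide,
  and the edge across the boundary needs no separate treatment.
\<close>

definition axis_vertex :: "nat \<Rightarrow> nat \<Rightarrow> nat \<Rightarrow> nat \<Rightarrow> int" where
  "axis_vertex d L k = (\<lambda>i\<in>{..<d}. if i = 0 then int (k mod L) else 0)"

text \<open>
  For \<open>L = 1\<close> consecutive vertices of the axis coincide and would form a loop.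
\<close>

lemma axis_edge_torus:
  assumes "d \<ge> 1" "L \<ge> 2"
  shows "{axis_vertex d L k, axis_vertex d L (Suc k)} \<in> edges (torus d L)"
proof -
  have "axis_vertex d L k \<in> {..<d} \<rightarrow>\<^sub>E {0..<int L}" for k
    using assms by (auto simp: axis_vertex_def)
  moreover have "torus_adj d L (axis_vertex d L k) (axis_vertex d L (Suc k))"
    unfolding torus_adj_def
  proof (intro exI[of _ 0] conjI)
    show "[axis_vertex d L k 0 - axis_vertex d L (Suc k) 0 = 1] (mod int L) \<or>
        [axis_vertex d L k 0 - axis_vertex d L (Suc k) 0 = - 1] (mod int L)"
      using assms by (intro disjI2) (simp add: axis_vertex_def cong_def zmod_int mod_simps)
    show "axis_vertex d L k 0 \<noteq> axis_vertex d L (Suc k) 0"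
      using assms by (auto simp: axis_vertex_def mod_Suc)
  qed (use assms in \<open>auto simp: axis_vertex_def\<close>)
  ultimately show ?thesis
    unfolding torus_def Let_def graph.sel by blast
qed

lemma inj_on_axis_vertex: "inj_on (axis_vertex d L) {..<L}" if "d \<ge> 1"
proof (rule inj_onI)
  fix j k assume "j \<in> {..<L}" "k \<in> {..<L}" "axis_vertex d L j = axis_vertex d L k"
  with that fun_cong[OF this(3), of 0] show "j = k"
    by (simp add: axis_vertex_def)
qed

text \<open>
  A union bound: each single edge is omitted with probability \<open>1 - q\<close>.
\<close>

lemma prob_some_edge_omitted:
  assumes "finite A" "C \<subseteq> A" "0 \<le> q" "q \<le> 1"
  shows "measure_pmf.prob (Pi_pmf A False (\<lambda>_. bernoulli_pmf q)) {\<omega>. \<exists>e\<in>C. \<not> \<omega> e}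
    \<le> real (card C) * (1 - q)"
proof -
  let ?P = "Pi_pmf A False (\<lambda>_. bernoulli_pmf q)"
  have "finite C"
    using assms finite_subset by blast
  have single: "measure_pmf.prob ?P {\<omega>. \<not> \<omega> e} = 1 - q" if "e \<in> C" for e
  proof -
    have "measure_pmf.prob ?P {\<omega>. \<not> \<omega> e} = measure_pmf.prob (map_pmf (\<lambda>\<omega>. \<omega> e) ?P) {False}"
      by (simp add: vimage_def)
    also have "map_pmf (\<lambda>\<omega>. \<omega> e) ?P = bernoulli_pmf q"
      using that assms by (subst Pi_pmf_component) auto
    finally show ?thesis
      using assms by (simp add: measure_pmf_single)
  qed
  have "{\<omega>. \<exists>e\<in>C. \<not> \<omega> e} = (\<Union>e\<in>C. {\<omega>. \<not> \<omega> e})"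
    by auto
  then have "measure_pmf.prob ?P {\<omega>. \<exists>e\<in>C. \<not> \<omega> e} \<le> (\<Sum>e\<in>C. measure_pmf.prob ?P {\<omega>. \<not> \<omega> e})"
    using measure_pmf.finite_measure_subadditive_finite[OF \<open>finite C\<close>, of "\<lambda>e. {\<omega>. \<not> \<omega> e}" ?P]
    by simp
  also have "\<dots> = real (card C) * (1 - q)"
    by (simp add: single)
  finally show ?thesis .
qed

lemma prob_pruned_percolation_models_bipartite:
  "measure_pmf.prob (map_pmf (prune m) (percolation G q)) {H. H \<Turnstile> bipartite_sentence} =
   measure_pmf.prob (Pi_pmf (edges G) False (\<lambda>_. bernoulli_pmf q))
     {\<omega>. bipartite (prune m (Graph (verts G) {e \<in> edges G. \<omega> e}))}"
  by (simp add: percolation_def vimage_def models_bipartite_sentence Union_edges_prune)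

lemma prob_bipartite_even:
  assumes "even L"
  shows "measure_pmf.prob (map_pmf (prune m) (percolation (torus d L) q))
    {H. H \<Turnstile> bipartite_sentence} = 1"
proof -
  have "bipartite (prune m (Graph (verts (torus d L)) {e \<in> edges (torus d L). \<omega> e}))" for \<omega>
    by (rule bipartite_antimono[OF bipartite_torus[OF assms]])
       (use edges_prune_subset in fastforce)
  then show ?thesis
    unfolding prob_pruned_percolation_models_bipartite by simp
qed

lemma prob_bipartite_odd:
  assumes "d \<ge> 1" "odd L" "L \<ge> 2" "m \<le> L" "0 \<le> q" "q \<le> 1"
  shows "measure_pmf.prob (map_pmf (prune m) (percolation (torus d L) q))
    {H. H \<Turnstile> bipartite_sentence} \<le> real L * (1 - q)"
proof -
  let ?c = "axis_vertex d L"
  let ?P = "Pi_pmf (edges (torus d L)) False (\<lambda>_. bernoulli_pmf q)"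
  let ?G = "\<lambda>\<omega>. Graph (verts (torus d L)) {e \<in> edges (torus d L). \<omega> e}"
  define C where "C = (\<lambda>k. {?c k, ?c (Suc k)}) ` {..<L}"
  have C_edges: "C \<subseteq> edges (torus d L)"
    using assms by (auto simp: C_def axis_edge_torus)
  have "\<not> bipartite (prune m (?G \<omega>))" if "\<forall>e\<in>C. \<omega> e" for \<omega>
  proof (rule odd_closed_walk_not_bipartite)
    show "{?c k, ?c (Suc k)} \<in> edges (prune m (?G \<omega>))" if "k < L" for k
    proof (rule path_survives_prune[of _ L])
      show "{?c j, ?c (Suc j)} \<in> edges (?G \<omega>)" if "j < L" for j
        using that \<open>\<forall>e\<in>C. \<omega> e\<close> C_edges by (auto simp: C_def)
    qed (use assms \<open>k < L\<close> Union_edges_torus in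
          \<open>auto simp: finite_verts_torus inj_on_axis_vertex\<close>)
    show "?c L = ?c 0"
      by (simp add: axis_vertex_def cong: if_cong)
  qed fact
  then have "{\<omega>. bipartite (prune m (?G \<omega>))} \<subseteq> {\<omega>. \<exists>e\<in>C. \<not> \<omega> e}"
    by blast
  then have "measure_pmf.prob ?P {\<omega>. bipartite (prune m (?G \<omega>))}
      \<le> measure_pmf.prob ?P {\<omega>. \<exists>e\<in>C. \<not> \<omega> e}"
    by (intro measure_pmf.finite_measure_mono) auto
  also have "\<dots> \<le> real (card C) * (1 - q)"
    using assms C_edges by (intro prob_some_edge_omitted finite_edges_torus)
  also have "\<dots> \<le> real L * (1 - q)"
    using card_image_le[of "{..<L}" "\<lambda>k. {?c k, ?c (Suc k)}"] assms
    by (intro mult_right_mono) (auto simp: C_def)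
  finally show ?thesis
    unfolding prob_pruned_percolation_models_bipartite .
qed

theorem corollary5p5:
  fixes d :: nat and q :: "nat \<Rightarrow> real" and f :: "nat \<Rightarrow> nat"
    and X Y :: "nat \<Rightarrow> (nat \<Rightarrow> int) graph pmf"
  assumes "d \<ge> 1"
    and "\<And>L. L \<ge> 1 \<Longrightarrow> 0 \<le> q (L ^ d) \<and> q (L ^ d) \<le> 1"
    and "(\<lambda>L. real L * (1 - q (L ^ d))) \<longlonglongrightarrow> 0"
    and "\<And>n. n \<ge> 1 \<Longrightarrow> f n \<ge> 1"
    and "(\<lambda>L. real (f (L ^ d))) \<in> o(\<lambda>L. real L)"
    and "\<And>L. L \<ge> 1 \<Longrightarrow> X L = percolation (torus d L) (q (L ^ d))"
    and "\<And>L. L \<ge> 1 \<Longrightarrow> Y L = map_pmf (prune (f (L ^ d))) (X L)"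
  shows "\<not> has_convergence_law MSO1_sentences Y \<and> \<not> has_convergence_law MSO2_sentences Y"
proof -
  define P where "P L = measure_pmf.prob (Y L) {G. G \<Turnstile> bipartite_sentence}" for L
  have Y: "Y L = map_pmf (prune (f (L ^ d))) (percolation (torus d L) (q (L ^ d)))"
    if "L \<ge> 1" for L
    using assms(6,7) that by simp
  have even_lim: "(\<lambda>n. P (2 * n + 2)) \<longlonglongrightarrow> 1"
    unfolding P_def by (subst Y, simp, subst prob_bipartite_even) auto
  have "\<forall>\<^sub>F L in sequentially. f (L ^ d) \<le> L"
    using landau_o.smallD[OF assms(5), of 1] by simp
  then have odd_bound: "\<forall>\<^sub>F L in sequentially. odd L \<longrightarrow> P L \<le> real L * (1 - q (L ^ d))"
    using eventually_ge_at_top[of 2]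
  proof eventually_elim
    case (elim L)
    then show ?case
      using assms(1) assms(2)[of L] unfolding P_def
      by (subst Y, simp) (blast intro: prob_bipartite_odd dest: order_trans[OF one_le_numeral])
  qed
  have odd_subseq: "filterlim (\<lambda>n::nat. 2 * n + 1) sequentially sequentially"
    by (intro filterlim_subseq) (simp add: strict_mono_def)
  have "\<forall>\<^sub>F n in sequentially.
      P (2 * n + 1) \<le> real (2 * n + 1) * (1 - q ((2 * n + 1) ^ d))"
    using eventually_compose_filterlim[OF odd_bound odd_subseq] by simp
  then have odd_lim: "(\<lambda>n. P (2 * n + 1)) \<longlonglongrightarrow> 0"
    by (rule tendsto_sandwich[rotated, OF _ tendsto_const filterlim_compose[OF assms(3) odd_subseq]])
       (simp add: P_def)
  have "\<not> convergent P"
  proof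
    assume "convergent P"
    then obtain l where l: "P \<longlonglongrightarrow> l"
      by (auto simp: convergent_def)
    have even_subseq: "filterlim (\<lambda>n::nat. 2 * n + 2) sequentially sequentially"
      by (intro filterlim_subseq) (simp add: strict_mono_def)
    have "l = 1"
      using filterlim_compose[OF l even_subseq] even_lim by (rule LIMSEQ_unique)
    moreover have "l = 0"
      using filterlim_compose[OF l odd_subseq] odd_lim by (rule LIMSEQ_unique)
    ultimately show False
      by simp
  qed
  moreover have "bipartite_sentence \<in> MSO2_sentences"
    using bipartite_sentence_MSO1 by (simp add: MSO1_sentences_def)
  ultimately show ?thesis
    using bipartite_sentence_MSO1 unfolding has_convergence_law_def P_def by blast
qed

end
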